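(* Let $T$ be a finite set and let $\boldsymbol\eta=(\eta_t)_{t\in T}$ be a random vector with values in $\{0,1\}^T$, with $0<\mathrm{P}(\eta_t=1)<1$ for every $t\in T$. For signal strength $\epsilon>0$, let $\boldsymbol X$ be an observation whose conditional density given $\boldsymbol\eta$ is $\rho(\boldsymbol x\,|\,\boldsymbol\eta)=e^{q(\boldsymbol x,\epsilon\boldsymbol\eta)}$, where $q$ is a real-valued function not depending on $\epsilon$. Suppose that for each $\boldsymbol x$, the function $\boldsymbol\theta\mapsto q(\boldsymbol x,\boldsymbol\theta)$ on $\mathbb{R}^T$ is twice continuously differentiable, and let $\gamma(\boldsymbol x)\in\mathbb{R}^T$ and $H(\boldsymbol x)\in\mathbb{R}^{T\times T}$ be its gradient and Hessian in $\boldsymbol\theta$ at $\boldsymbol\theta=\boldsymbol 0$, respectively. Let $$r_t(\boldsymbol X)=\ln\frac{\mathrm{P}(\eta_t=1\,|\,\boldsymbol X)}{\mathrm{P}(\eta_t=0\,|\,\boldsymbol X)},\qquad t\in T.$$ Then for every $t\in T$, as $\epsilon\to0$, $$\begin{aligned} r_t(\boldsymbol X)={}&\ln\frac{\mathrm{P}(\eta_t=1)}{\mathrm{P}(\eta_t=0)}+\gamma(\boldsymbol X)^{\mathrm t}\,[\mathrm{E}_{1t}(\boldsymbol\eta)-\mathrm{E}_{0t}(\boldsymbol\eta)]\,\epsilon\\ &+\tfrac12\,[\mathrm{E}_{1t}(\boldsymbol\eta^{\mathrm t}H(\boldsymbol X)\boldsymbol\eta)-\mathrm{E}_{0t}(\boldsymbol\eta^{\mathrm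 t}H(\boldsymbol X)\boldsymbol\eta)]\,\epsilon^2\\ &+\tfrac12\,\gamma(\boldsymbol X)^{\mathrm t}\,[\mathrm{Cov}_{1t}(\boldsymbol\eta)-\mathrm{Cov}_{0t}(\boldsymbol\eta)]\,\gamma(\boldsymbol X)\,\epsilon^2+o_{t,\boldsymbol X}(\epsilon^2),\end{aligned}$$ where $o_{t,\boldsymbol X}(\cdot)$ means that the implicit constant depends on $t$ and on the value of $\boldsymbol X$; that is, the expansion holds for each $t$ and each fixed value $\boldsymbol X=\boldsymbol x$.
   Context: Elements of $\mathbb{R}^T$ are treated as column vectors indexed by $T$, and $^{\mathrm t}$ denotes transpose. The observation $\boldsymbol X$ takes values in an arbitrary measurable space with a fixed reference measure; for each $\epsilon>0$ and each $\boldsymbol\sigma\in\{0,1\}^T$, $\boldsymbol x\mapsto e^{q(\boldsymbol x,\epsilon\boldsymbol\sigma)}$ is the probability density of $\boldsymbol X$ given $\boldsymbol\eta=\boldsymbol\sigma$ with respect to this measure. The distribution of $\boldsymbol\eta$ is arbitrary and does not depend on $\epsilon$. For $i\in\{0,1\}$ and $t\in T$, $\mathrm{E}_{it}(\cdot)=\mathrm{E}(\cdot\,|\,\eta_t=i)$ and $\mathrm{Cov}_{it}(\cdot)=\mathrm{Cov}(\cdot\,|\,\eta_t=i)$ denote expectation and covariance matrix under the conditional law of $\boldsymbol\eta$ given $\eta_t=i$; in $\mathrm{E}_{it}(\boldsymbol\eta^{\mathrm t}H(\boldsymbol X)\boldsymbol\eta)$ the value of $\boldsymbol X$ is held fixed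 and the expectation is over $\boldsymbol\eta$ only. The conditional probability $\mathrm{P}(\eta_t=i\,|\,\boldsymbol X)$ is the one given by Bayes' rule: it is proportional (in $i\in\{0,1\}$) to $\mathrm{P}(\eta_t=i)\,\rho_{it}(\boldsymbol X)$, where $\rho_{it}(\boldsymbol x)=\sum_{\boldsymbol\sigma\in\{0,1\}^T:\,\sigma_t=i}\mathrm{P}(\boldsymbol\eta=\boldsymbol\sigma\,|\,\eta_t=i)\,e^{q(\boldsymbol x,\epsilon\boldsymbol\sigma)}$. Thus $r_t(\boldsymbol x)$ depends on $\epsilon$. *)

theory Defs
  imports "HOL-Probability.Probability" "HOL-Library.Landau_Symbols"
begin

definition gradient :: "(real^'t::finite \<Rightarrow> real) \<Rightarrow> real^'t \<Rightarrow> real^'t" where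
  "gradient f \<theta> = (\<chi> s. frechet_derivative f (at \<theta>) (axis s 1))"

definition hessian :: "(real^'t::finite \<Rightarrow> real) \<Rightarrow> real^'t \<Rightarrow> real^'t^'t" where
  "hessian f \<theta> = jacobian (gradient f) (at \<theta>)"

(* Differentiability is required explicitly because gradient and hessian are
   arbitrary values where f, respectively gradient f, is not differentiable. *)
definition twice_continuously_differentiable :: "(real^'t::finite \<Rightarrow> real) \<Rightarrow> bool" where
  "twice_continuously_differentiable f \<longleftrightarrow>
     (\<forall>\<theta>. f differentiable (at \<theta>)) \<and>
     (\<forall>\<theta>. gradient f differentiable (at \<theta>)) \<and>
     continuous_on UNIV (hessian f)"

definition binary_vectors :: "(real^'t::finite) set" where
  "binary_vectors = {\<sigma>. \<forall>s. \<sigma> $ s \<in> {0, 1}}"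

lemma finite_binary_vectors: "finite (binary_vectors :: (real^'t::finite) set)"
proof -
  have "(binary_vectors :: (real^'t) set) \<subseteq> (\<lambda>S. \<chi> s. if s \<in> S then 1 else 0) ` UNIV"
  proof
    fix \<sigma> :: "real^'t" assume "\<sigma> \<in> binary_vectors"
    then have "\<sigma> = (\<chi> s. if s \<in> {s. \<sigma> $ s = 1} then 1 else 0)"
      by (auto simp: binary_vectors_def vec_eq_iff)
    then show "\<sigma> \<in> (\<lambda>S. \<chi> s. if s \<in> S then 1 else 0) ` UNIV" by blast
  qed
  then show ?thesis by (rule finite_subset) simp
qed

(* uniform_measure M A is the conditional probability P( . | A) on the space of M. *)
definition cond_on_coord ::
    "'w measure \<Rightarrow> ('w \<Rightarrow> real^'t::finite) \<Rightarrow> real \<Rightarrow> 't \<Rightarrow> 'w measure" where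
  "cond_on_coord M \<eta> i t = uniform_measure M {w \<in> space M. \<eta> w $ t = i}"

definition cond_exp_coord ::
    "'w measure \<Rightarrow> ('w \<Rightarrow> real^'t::finite) \<Rightarrow> real \<Rightarrow> 't \<Rightarrow> (real^'t \<Rightarrow> 'b) \<Rightarrow>
     'b::{banach, second_countable_topology}" where
  "cond_exp_coord M \<eta> i t f = (\<integral>w. f (\<eta> w) \<partial>cond_on_coord M \<eta> i t)"

definition cond_cov_coord ::
    "'w measure \<Rightarrow> ('w \<Rightarrow> real^'t::finite) \<Rightarrow> real \<Rightarrow> 't \<Rightarrow> real^'t^'t" where
  "cond_cov_coord M \<eta> i t =
     (let m = cond_exp_coord M \<eta> i t (\<lambda>\<sigma>. \<sigma>)
      in \<chi> j k. cond_exp_coord M \<eta> i t (\<lambda>\<sigma>. (\<sigma> $ j - m $ j) * (\<sigma> $ k - m $ k)))"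

(* The density of X given eta_t = i, as the mixture over sigma of the densities
   exp (q x (epsilon sigma)) of X given eta = sigma. *)
definition coord_density ::
    "'w measure \<Rightarrow> ('w \<Rightarrow> real^'t::finite) \<Rightarrow> ('x \<Rightarrow> real^'t \<Rightarrow> real) \<Rightarrow> real \<Rightarrow>
     real \<Rightarrow> 't \<Rightarrow> 'x \<Rightarrow> real" where
  "coord_density M \<eta> q \<epsilon> i t x =
     (\<Sum>\<sigma> | \<sigma> \<in> binary_vectors \<and> \<sigma> $ t = i.
        \<P>(w in M. \<eta> w = \<sigma> \<bar> \<eta> w $ t = i) * exp (q x (\<epsilon> *\<^sub>R \<sigma>)))"

(* P(eta_t = i | X = x) by Bayes' rule. *)
definition posterior ::
    "'w measure \<Rightarrow> ('w \<Rightarrow> real^'t::finite) \<Rightarrow> ('x \<Rightarrow> real^'t \<Rightarrow> real) \<Rightarrow> real \<Rightarrow>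
     real \<Rightarrow> 't \<Rightarrow> 'x \<Rightarrow> real" where
  "posterior M \<eta> q \<epsilon> i t x =
     \<P>(w in M. \<eta> w $ t = i) * coord_density M \<eta> q \<epsilon> i t x /
     (\<Sum>j\<in>{0, 1}. \<P>(w in M. \<eta> w $ t = j) * coord_density M \<eta> q \<epsilon> j t x)"

definition log_odds ::
    "'w measure \<Rightarrow> ('w \<Rightarrow> real^'t::finite) \<Rightarrow> ('x \<Rightarrow> real^'t \<Rightarrow> real) \<Rightarrow> real \<Rightarrow>
     't \<Rightarrow> 'x \<Rightarrow> real" where
  "log_odds M \<eta> q \<epsilon> t x = ln (posterior M \<eta> q \<epsilon> 1 t x / posterior M \<eta> q \<epsilon> 0 t x)"

end

theory Submission
  imports Defs
begin

text \<open>
  Fix \<open>x\<close> and \<open>t\<close>. By Bayes' rule the log-odds equal the prior log-odds plus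
  \<open>ln S\<^sub>1(\<epsilon>) - ln S\<^sub>0(\<epsilon>)\<close>, where \<open>S\<^sub>i\<close> is the finite mixture \<open>E\<^sub>i\<^sub>t (exp (q(x, \<epsilon>\<eta>)))\<close>.
  Each \<open>ln S\<^sub>i\<close> is differentiable near \<open>0\<close>, and its derivative is differentiable at \<open>0\<close>, so Taylor's
  formula with Peano remainder applies. As for a cumulant generating function, the first two
  derivatives at \<open>0\<close> are the mean of \<open>\<gamma> \<bullet> \<eta>\<close>, and the mean of \<open>\<eta> \<bullet> H \<eta>\<close> plus the variance of
  \<open>\<gamma> \<bullet> \<eta>\<close>. The constant terms \<open>q(x, 0)\<close> cancel.
\<close>

section \<open>Second-order expansions in one real variable\<close>

lemma taylor2_peano_at_right:
  fixes f f' :: "real \<Rightarrow> real"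
  assumes f: "\<And>e. (f has_real_derivative f' e) (at e)"
    and f': "(f' has_real_derivative f'') (at 0)"
  shows "(\<lambda>e. f e - (f 0 + f' 0 * e + f'' / 2 * e\<^sup>2)) \<in> o[at_right 0](\<lambda>e. e\<^sup>2)"
proof (rule smalloI_tendsto)
  show "\<forall>\<^sub>F e in at_right 0. e\<^sup>2 \<noteq> (0::real)"
    by (auto simp: eventually_at_filter)
  define g where "g e = f e - (f 0 + f' 0 * e + f'' / 2 * e\<^sup>2)" for e
  have dg: "(g has_real_derivative (f' e - f' 0 - f'' * e)) (at e)" for e
    unfolding g_def by (auto intro!: derivative_eq_intros f)
  have "isCont g 0" using dg DERIV_isCont by blast
  then have "(g \<longlongrightarrow> g 0) (at_right 0)"
    unfolding isCont_def by (rule tendsto_mono[rotated]) (simp add: at_le)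
  then have g0: "(g \<longlongrightarrow> 0) (at_right 0)" by (simp add: g_def)
  \<comment> \<open>Since \<open>f'\<close> is known to be differentiable only at 0, L'Hopital's
    rule can be used just once on \<open>g e / e\<^sup>2\<close>. The resulting quotient of
    derivatives is half the error of the difference quotient of \<open>f'\<close> at 0.\<close>
  have "((\<lambda>e. (f' e - f' 0) / e) \<longlongrightarrow> f'') (at 0)"
    using f' by (simp add: has_field_derivative_iff)
  then have "((\<lambda>e. (f' e - f' 0) / e) \<longlongrightarrow> f'') (at_right 0)"
    by (rule tendsto_mono[rotated]) (simp add: at_le)
  then have "((\<lambda>e. ((f' e - f' 0) / e - f'') / 2) \<longlongrightarrow> (f'' - f'') / 2) (at_right 0)"
    by (intro tendsto_intros) auto
  then have lim: "((\<lambda>e. (f' e - f' 0 - f'' * e) / (2 * e)) \<longlongrightarrow> 0) (at_right 0)"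
    unfolding diff_self div_0
    by (rule tendsto_cong[THEN iffD1, rotated]) (auto simp: eventually_at_filter field_simps)
  have "((\<lambda>e. g e / e\<^sup>2) \<longlongrightarrow> 0) (at_right 0)"
  proof (rule lhopital_right_0[OF g0 _ _ _ _ _ lim])
    show "((\<lambda>e::real. e\<^sup>2) \<longlongrightarrow> 0) (at_right 0)"
      by (auto intro!: tendsto_eq_intros)
    show "\<forall>\<^sub>F e in at_right 0. ((\<lambda>e::real. e\<^sup>2) has_real_derivative 2 * e) (at e)"
      by (auto intro!: derivative_eq_intros always_eventually)
  qed (auto simp: eventually_at_filter dg)
  then show "((\<lambda>e. (f e - (f 0 + f' 0 * e + f'' / 2 * e\<^sup>2)) / e\<^sup>2) \<longlongrightarrow> 0) (at_right 0)"
    by (simp add: g_def)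
qed

text \<open>All exponents agree at 0, so every exponential there is \<open>exp c\<close>. This
  factor cancels in \<open>S'/S\<close> and in its derivative \<open>S''/S - (S'/S)\<^sup>2\<close>,
  which leaves plain averages with weights \<open>p\<close>.\<close>

lemma ln_exp_mixture_taylor2:
  fixes p b :: "'a \<Rightarrow> real" and L L' :: "'a \<Rightarrow> real \<Rightarrow> real"
  assumes p: "\<And>s. s \<in> B \<Longrightarrow> 0 \<le> p s" "(\<Sum>s\<in>B. p s) = 1"
    and L0: "\<And>s. s \<in> B \<Longrightarrow> L s 0 = c"
    and L: "\<And>s e. s \<in> B \<Longrightarrow> (L s has_real_derivative L' s e) (at e)"
    and L': "\<And>s. s \<in> B \<Longrightarrow> (L' s has_real_derivative b s) (at 0)"
  shows "(\<lambda>e. ln (\<Sum>s\<in>B. p s * exp (L s e)) -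
      (c + (\<Sum>s\<in>B. p s * L' s 0) * e
        + ((\<Sum>s\<in>B. p s * b s) + ((\<Sum>s\<in>B. p s * (L' s 0)\<^sup>2) - (\<Sum>s\<in>B. p s * L' s 0)\<^sup>2)) / 2 * e\<^sup>2))
    \<in> o[at_right 0](\<lambda>e. e\<^sup>2)"
proof -
  define S S' where "S e = (\<Sum>s\<in>B. p s * exp (L s e))"
    and "S' e = (\<Sum>s\<in>B. p s * (exp (L s e) * L' s e))" for e
  define m v w where "m = (\<Sum>s\<in>B. p s * L' s 0)" and "v = (\<Sum>s\<in>B. p s * (L' s 0)\<^sup>2)"
    and "w = (\<Sum>s\<in>B. p s * b s)"
  \<comment> \<open>A sum over an infinite set is 0 by convention, which contradicts total weight
    1.\<close>
  have fin: "finite B" using p(2) sum.infinite by fastforce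
  obtain s where s: "s \<in> B" "p s \<noteq> 0"
    using p(2) by (metis sum.neutral zero_neq_one)
  then have "0 < p s" using p(1) by fastforce
  then have Spos: "0 < S e" for e
    unfolding S_def using s(1) fin p(1) by (intro sum_pos2) auto
  have dS: "(S has_real_derivative S' e) (at e)" for e
    unfolding S_def[abs_def] S'_def
    by (rule DERIV_sum) (auto intro!: derivative_eq_intros L)
  have S0: "S 0 = exp c"
    using p(2) by (simp add: S_def L0 flip: sum_distrib_right)
  have S'0: "S' 0 = exp c * m"
    by (simp add: S'_def m_def L0 sum_distrib_left mult_ac)
  have "(S' has_real_derivative (\<Sum>s\<in>B. p s * (exp c * (L' s 0)\<^sup>2 + exp c * b s))) (at 0)"
    unfolding S'_def[abs_def]
    by (rule DERIV_sum)
       (auto intro!: derivative_eq_intros L L' simp: L0 algebra_simps power2_eq_square)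
  then have dS': "(S' has_real_derivative exp c * (v + w)) (at 0)"
    by (simp add: v_def w_def sum_distrib_left sum.distrib algebra_simps)
  have d1: "((\<lambda>e. ln (S e)) has_real_derivative S' e / S e) (at e)" for e
    using Spos[of e] by (auto intro!: derivative_eq_intros dS)
  have "((\<lambda>e. S' e / S e) has_real_derivative
      (exp c * (v + w) * S 0 - S' 0 * S' 0) / (S 0 * S 0)) (at 0)"
    using Spos[of 0] by (intro DERIV_divide dS dS') simp
  \<comment> \<open>Numerator and denominator both carry the factor \<open>exp c\<close>
    squared.\<close>
  also have "(exp c * (v + w) * S 0 - S' 0 * S' 0) / (S 0 * S 0) = w + (v - m\<^sup>2)"
    by (simp add: S0 S'0 field_simps power2_eq_square)
  finally have d2: "((\<lambda>e. S' e / S e) has_real_derivative w + (v - m\<^sup>2)) (at 0)" .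
  show ?thesis
    using taylor2_peano_at_right[OF d1 d2]
    by (simp add: S0 S'0 flip: S_def m_def v_def w_def)
qed

section \<open>Gradient and Hessian along lines through the origin\<close>

lemma frechet_derivative_eq_inner_gradient:
  assumes "f differentiable (at \<theta>)"
  shows "frechet_derivative f (at \<theta>) v = gradient f \<theta> \<bullet> v"
proof -
  interpret D: linear "frechet_derivative f (at \<theta>)"
    using assms by (rule linear_frechet_derivative)
  have "frechet_derivative f (at \<theta>) v = frechet_derivative f (at \<theta>) (\<Sum>s\<in>UNIV. v $ s *\<^sub>R axis s 1)"
    by (simp add: basis_expansion flip: scalar_mult_eq_scaleR)
  then show ?thesis
    by (simp add: D.sum D.scaleR gradient_def inner_vec_def mult.commute)
qed

text \<open>The chain rule, with the codomain of \<open>f\<close> left general: it serves both for a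
  real function and for its vector-valued gradient.\<close>

lemma frechet_derivative_along_line:
  assumes "f differentiable (at (e *\<^sub>R v))"
  shows "((\<lambda>e. f (e *\<^sub>R v)) has_derivative
    (\<lambda>h. frechet_derivative f (at (e *\<^sub>R v)) (h *\<^sub>R v))) (at e)"
  using assms unfolding frechet_derivative_works
  by (rule has_derivative_compose[OF has_derivative_scaleR_left[OF has_derivative_ident]])

lemma has_real_derivative_along_line:
  assumes "f differentiable (at (e *\<^sub>R v))"
  shows "((\<lambda>e. f (e *\<^sub>R v)) has_real_derivative gradient f (e *\<^sub>R v) \<bullet> v) (at e)"
proof -
  have "((\<lambda>e. f (e *\<^sub>R v)) has_derivative
      (\<lambda>h. frechet_derivative f (at (e *\<^sub>R v)) (h *\<^sub>R v))) (at e)"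
    by (rule frechet_derivative_along_line[OF assms])
  then show ?thesis
    by (rule has_derivative_imp_has_field_derivative)
       (simp add: frechet_derivative_eq_inner_gradient[OF assms])
qed

lemma gradient_has_real_derivative_along_line:
  assumes "gradient f differentiable (at (e *\<^sub>R v))"
  shows "((\<lambda>e. gradient f (e *\<^sub>R v) \<bullet> v) has_real_derivative v \<bullet> (hessian f (e *\<^sub>R v) *v v)) (at e)"
proof -
  let ?D = "frechet_derivative (gradient f) (at (e *\<^sub>R v))"
  have "((\<lambda>e. gradient f (e *\<^sub>R v)) has_derivative (\<lambda>h. ?D (h *\<^sub>R v))) (at e)"
    by (rule frechet_derivative_along_line[OF assms])
  then have "((\<lambda>e. gradient f (e *\<^sub>R v) \<bullet> v) has_derivative (\<lambda>h. ?D (h *\<^sub>R v) \<bullet> v)) (at e)"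
    by (rule has_derivative_inner_left)
  \<comment> \<open>The matrix of a map reproduces the map only if the map is linear, hence the
    appeal to \<open>linear_frechet_derivative\<close>.\<close>
  moreover have "?D u = hessian f (e *\<^sub>R v) *v u" for u
    using linear_frechet_derivative[OF assms]
    by (simp add: hessian_def jacobian_def matrix_works)
  ultimately show ?thesis
    by (intro has_derivative_imp_has_field_derivative)
       (auto simp: matrix_vector_mult_scaleR inner_commute)
qed

section \<open>The conditional law of \<eta> given one coordinate\<close>

lemma borel_measurable_vec_nth [measurable (raw)]:
  fixes f :: "'a \<Rightarrow> real^'n::finite"
  assumes "f \<in> borel_measurable M"
  shows "(\<lambda>w. f w $ s) \<in> borel_measurable M"
  using assms
  by (rule measurable_compose)
     (simp add: borel_measurable_continuous_onI continuous_on_component)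

text \<open>The conditioning value \<open>i\<close> is a parameter because the theorem interprets
  the locale twice, with 0 and with 1. By \<open>coord_pos\<close>, conditioning yields a genuine
  probability measure.\<close>

locale random_binary_vector = prob_space M for M :: "'w measure" +
  fixes \<eta> :: "'w \<Rightarrow> real^'t::finite" and i :: real and t :: 't
  assumes measurable_eta [measurable]: "\<eta> \<in> borel_measurable M"
    and eta_binary: "\<And>w. w \<in> space M \<Longrightarrow> \<eta> w \<in> binary_vectors"
    and coord_pos: "0 < \<P>(w in M. \<eta> w $ t = i)"
begin

definition weight :: "real^'t \<Rightarrow> real" where
  "weight \<sigma> = \<P>(w in M. \<eta> w = \<sigma> \<bar> \<eta> w $ t = i)"

text \<open>The index set of the mixture \<open>coord_density\<close>. It may contain vectors of
  weight 0, so it can exceed the support of the conditional law.\<close>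

definition support :: "(real^'t) set" where
  "support = {\<sigma>. \<sigma> \<in> binary_vectors \<and> \<sigma> $ t = i}"

lemma finite_support: "finite support"
  using finite_binary_vectors by (rule rev_finite_subset) (auto simp: support_def)

lemma weight_nonneg: "0 \<le> weight \<sigma>"
  by (simp add: weight_def cond_prob_def)

lemma weight_outside_support:
  assumes "\<sigma> $ t \<noteq> i"
  shows "weight \<sigma> = 0"
proof -
  have empty: "{w \<in> space M. \<eta> w = \<sigma> \<and> \<eta> w $ t = i} = {}"
    using assms by auto
  show ?thesis
    unfolding weight_def cond_prob_def empty by simp
qed

text \<open>Since \<eta> takes finitely many values, \<open>f (\<eta> w)\<close> is a finite
  combination of indicators of the events \<open>?E \<sigma>\<close>, and each integrates to its
  conditional probability. Values in a Banach space cover the mean vector as well as real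
  expectations.\<close>

lemma cond_exp_coord_eq_sum:
  fixes f :: "real^'t \<Rightarrow> 'b::{banach, second_countable_topology}"
  shows "cond_exp_coord M \<eta> i t f = (\<Sum>\<sigma>\<in>support. weight \<sigma> *\<^sub>R f \<sigma>)"
proof -
  let ?A = "{w \<in> space M. \<eta> w $ t = i}"
  let ?U = "uniform_measure M ?A"
  let ?E = "\<lambda>\<sigma>. {w \<in> space M. \<eta> w = \<sigma>}"
  have A0: "emeasure M ?A \<noteq> 0"
    using coord_pos by (auto simp: emeasure_eq_measure)
  interpret U: prob_space ?U
    using A0 by (intro prob_space_uniform_measure) auto
  have [measurable]: "?E \<sigma> \<in> sets M" for \<sigma>
    by measurable
  have m: "measure ?U (?E \<sigma>) = weight \<sigma>" for \<sigma>
  proof -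
    have "?A \<inter> ?E \<sigma> = {w \<in> space M. \<eta> w = \<sigma> \<and> \<eta> w $ t = i}" by auto
    then show ?thesis
      using A0 by (simp add: measure_uniform_measure weight_def cond_prob_def)
  qed
  have "(\<integral>w. f (\<eta> w) \<partial>?U) = (\<integral>w. (\<Sum>\<sigma>\<in>binary_vectors. indicat_real (?E \<sigma>) w *\<^sub>R f \<sigma>) \<partial>?U)"
  proof (rule Bochner_Integration.integral_cong[OF refl])
    fix w assume "w \<in> space ?U"
    then have w: "w \<in> space M" by simp
    have "(\<Sum>\<sigma>\<in>binary_vectors. indicat_real (?E \<sigma>) w *\<^sub>R f \<sigma>)
        = (\<Sum>\<sigma>\<in>binary_vectors. if \<sigma> = \<eta> w then f \<sigma> else 0)"
      using w by (intro sum.cong) (auto simp: indicator_def)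
    then show "f (\<eta> w) = (\<Sum>\<sigma>\<in>binary_vectors. indicat_real (?E \<sigma>) w *\<^sub>R f \<sigma>)"
      using eta_binary[OF w] by (simp add: finite_binary_vectors)
  qed
  also have "\<dots> = (\<Sum>\<sigma>\<in>binary_vectors. \<integral>w. indicat_real (?E \<sigma>) w *\<^sub>R f \<sigma> \<partial>?U)"
    by (intro Bochner_Integration.integral_sum integrable_scaleR_left)
       (simp_all add: U.emeasure_eq_measure)
  also have "\<dots> = (\<Sum>\<sigma>\<in>binary_vectors. weight \<sigma> *\<^sub>R f \<sigma>)"
  proof (rule sum.cong[OF refl])
    fix \<sigma>
    have "(\<integral>w. indicat_real (?E \<sigma>) w *\<^sub>R f \<sigma> \<partial>?U) = (\<integral>w. indicat_real (?E \<sigma>) w \<partial>?U) *\<^sub>R f \<sigma>"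
      by (rule integral_scaleR_left) (simp add: U.emeasure_eq_measure)
    also have "(\<integral>w. indicat_real (?E \<sigma>) w \<partial>?U) = weight \<sigma>"
      by (subst Bochner_Integration.integral_indicator)
         (simp_all add: m Int_absorb2 subset_eq)
    finally show "(\<integral>w. indicat_real (?E \<sigma>) w *\<^sub>R f \<sigma> \<partial>?U) = weight \<sigma> *\<^sub>R f \<sigma>" .
  qed
  \<comment> \<open>Binary vectors whose coordinate \<open>t\<close> differs from \<open>i\<close>
    have weight 0.\<close>
  also have "\<dots> = (\<Sum>\<sigma>\<in>support. weight \<sigma> *\<^sub>R f \<sigma>)"
    by (rule sum.mono_neutral_right[OF finite_binary_vectors])
       (auto simp: support_def weight_outside_support)
  finally show ?thesis
    by (simp add: cond_exp_coord_def cond_on_coord_def)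
qed

lemma sum_weight: "(\<Sum>\<sigma>\<in>support. weight \<sigma>) = 1"
proof -
  have "prob_space (cond_on_coord M \<eta> i t)"
    unfolding cond_on_coord_def using coord_pos
    by (intro prob_space_uniform_measure) (auto simp: emeasure_eq_measure)
  then show ?thesis
    using cond_exp_coord_eq_sum[of "\<lambda>_. 1 :: real"]
    by (simp add: cond_exp_coord_def prob_space.prob_space)
qed

lemma cond_exp_coord_inner:
  "g \<bullet> cond_exp_coord M \<eta> i t (\<lambda>\<sigma>. \<sigma>) = (\<Sum>\<sigma>\<in>support. weight \<sigma> * (g \<bullet> \<sigma>))"
  by (simp add: cond_exp_coord_eq_sum inner_sum_right)

text \<open>Both sides are the conditional variance of the scalar \<open>g \<bullet> \<eta>\<close>.
  The right side has the form in which the mixture expansion produces it.\<close>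

lemma cond_cov_coord_quadratic_form:
  "g \<bullet> (cond_cov_coord M \<eta> i t *v g)
    = (\<Sum>\<sigma>\<in>support. weight \<sigma> * (g \<bullet> \<sigma>)\<^sup>2) - (\<Sum>\<sigma>\<in>support. weight \<sigma> * (g \<bullet> \<sigma>))\<^sup>2"
proof -
  define m where "m = cond_exp_coord M \<eta> i t (\<lambda>\<sigma>. \<sigma>)"
  have gm: "(\<Sum>\<sigma>\<in>support. weight \<sigma> * (g \<bullet> \<sigma>)) = g \<bullet> m"
    by (simp add: m_def cond_exp_coord_inner)
  have "g \<bullet> (cond_cov_coord M \<eta> i t *v g) = (\<Sum>j\<in>UNIV. \<Sum>k\<in>UNIV. \<Sum>\<sigma>\<in>support.
      weight \<sigma> * ((g $ j * (\<sigma> - m) $ j) * (g $ k * (\<sigma> - m) $ k)))"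
    by (simp add: cond_cov_coord_def Let_def inner_vec_def matrix_vector_mult_def
        cond_exp_coord_eq_sum[where 'b=real] sum_distrib_left sum_distrib_right mult_ac flip: m_def)
  \<comment> \<open>With \<sigma> outermost, the double sum over \<open>j\<close> and
    \<open>k\<close> factors into a square.\<close>
  also have "\<dots> = (\<Sum>\<sigma>\<in>support. \<Sum>j\<in>UNIV. \<Sum>k\<in>UNIV.
      weight \<sigma> * ((g $ j * (\<sigma> - m) $ j) * (g $ k * (\<sigma> - m) $ k)))"
    by (subst (2) sum.swap, subst sum.swap) (rule refl)
  also have "\<dots> = (\<Sum>\<sigma>\<in>support. weight \<sigma> * (g \<bullet> (\<sigma> - m))\<^sup>2)"
    unfolding inner_vec_def inner_real_def power2_eq_square sum_product
    by (simp only: sum_distrib_left)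
  \<comment> \<open>Expanding the square about the mean; \<open>gm\<close> evaluates the cross term
    and \<open>sum_weight\<close> the constant one.\<close>
  also have "\<dots> = (\<Sum>\<sigma>\<in>support. weight \<sigma> * (g \<bullet> \<sigma>)\<^sup>2 - 2 * (g \<bullet> m) * (weight \<sigma> * (g \<bullet> \<sigma>))
      + (g \<bullet> m)\<^sup>2 * weight \<sigma>)"
    by (intro sum.cong) (simp_all add: inner_diff_right power2_eq_square algebra_simps)
  also have "\<dots> = (\<Sum>\<sigma>\<in>support. weight \<sigma> * (g \<bullet> \<sigma>)\<^sup>2) - 2 * (g \<bullet> m) * (g \<bullet> m) + (g \<bullet> m)\<^sup>2"
    by (simp only: sum.distrib sum_subtractf sum_distrib_left[symmetric] gm sum_weight mult_1_right)
  finally show ?thesis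
    by (simp add: gm power2_eq_square)
qed

lemma coord_density_eq:
  "coord_density M \<eta> q \<epsilon> i t x = (\<Sum>\<sigma>\<in>support. weight \<sigma> * exp (q x (\<epsilon> *\<^sub>R \<sigma>)))"
  by (simp add: coord_density_def support_def weight_def)

text \<open>The weights sum to 1, so one of them is positive. Positivity is what later allows the
  logarithm of the posterior ratio to be split.\<close>

lemma coord_density_pos: "0 < coord_density M \<eta> q \<epsilon> i t x"
proof -
  obtain \<sigma> where "\<sigma> \<in> support" "weight \<sigma> \<noteq> 0"
    using sum_weight by (metis sum.neutral zero_neq_one)
  then show ?thesis
    unfolding coord_density_eq using weight_nonneg[of \<sigma>]
    by (intro sum_pos2[of _ \<sigma>]) (auto simp: finite_support weight_nonneg order_less_le)
qed

text \<open>The mixture expansion with exponents \<open>q x (\<epsilon> *\<^sub>R \<sigma>)\<close>.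
  Every line passes through the origin at \<epsilon> = 0, so the common value is
  \<open>q x 0\<close>.\<close>

lemma ln_coord_density_expansion:
  assumes q: "twice_continuously_differentiable (q x)"
  shows "(\<lambda>\<epsilon>. ln (coord_density M \<eta> q \<epsilon> i t x) -
      (q x 0 + (gradient (q x) 0 \<bullet> cond_exp_coord M \<eta> i t (\<lambda>\<sigma>. \<sigma>)) * \<epsilon>
        + (cond_exp_coord M \<eta> i t (\<lambda>\<sigma>. \<sigma> \<bullet> (hessian (q x) 0 *v \<sigma>))
           + gradient (q x) 0 \<bullet> (cond_cov_coord M \<eta> i t *v gradient (q x) 0)) / 2 * \<epsilon>\<^sup>2))
    \<in> o[at_right 0](\<lambda>\<epsilon>. \<epsilon>\<^sup>2)"
proof -
  have "((\<lambda>e. gradient (q x) (e *\<^sub>R \<sigma>) \<bullet> \<sigma>) has_real_derivative \<sigma> \<bullet> (hessian (q x) 0 *v \<sigma>)) (at 0)" for \<sigma>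
    using q gradient_has_real_derivative_along_line[of "q x" 0 \<sigma>]
    by (simp add: twice_continuously_differentiable_def)
  moreover have "((\<lambda>e. q x (e *\<^sub>R \<sigma>)) has_real_derivative gradient (q x) (e *\<^sub>R \<sigma>) \<bullet> \<sigma>) (at e)" for \<sigma> e
    using q by (simp add: twice_continuously_differentiable_def has_real_derivative_along_line)
  ultimately show ?thesis
    using ln_exp_mixture_taylor2[of support weight "\<lambda>\<sigma> e. q x (e *\<^sub>R \<sigma>)" "q x 0"
        "\<lambda>\<sigma> e. gradient (q x) (e *\<^sub>R \<sigma>) \<bullet> \<sigma>" "\<lambda>\<sigma>. \<sigma> \<bullet> (hessian (q x) 0 *v \<sigma>)"]
    by (simp add: weight_nonneg sum_weight coord_density_eq cond_exp_coord_inner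
        cond_cov_coord_quadratic_form cond_exp_coord_eq_sum[where 'b=real])
qed

end

section \<open>Bayes' rule and the difference of the two expansions\<close>

theorem theorem3p2:
  fixes M :: "'w measure"
    and \<eta> :: "'w \<Rightarrow> real^'t::finite"
    and N :: "'x measure"
    and X :: "real \<Rightarrow> 'w \<Rightarrow> 'x"
    and q :: "'x \<Rightarrow> real^'t \<Rightarrow> real"
    and \<gamma> :: "'x \<Rightarrow> real^'t"
    and H :: "'x \<Rightarrow> real^'t^'t"
  assumes "prob_space M"
    and "\<eta> \<in> borel_measurable M"
    and "\<And>w. w \<in> space M \<Longrightarrow> \<eta> w \<in> binary_vectors"
    and "\<And>t. 0 < \<P>(w in M. \<eta> w $ t = 1)"
    and "\<And>t. \<P>(w in M. \<eta> w $ t = 1) < 1"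
    and "\<And>\<epsilon> \<sigma>. 0 < \<epsilon> \<Longrightarrow> \<sigma> \<in> binary_vectors \<Longrightarrow>
           (\<lambda>x. exp (q x (\<epsilon> *\<^sub>R \<sigma>))) \<in> borel_measurable N"
    and "\<And>\<epsilon> \<sigma>. 0 < \<epsilon> \<Longrightarrow> \<sigma> \<in> binary_vectors \<Longrightarrow>
           prob_space (density N (\<lambda>x. ennreal (exp (q x (\<epsilon> *\<^sub>R \<sigma>)))))"
    and "\<And>\<epsilon>. 0 < \<epsilon> \<Longrightarrow> X \<epsilon> \<in> measurable M N"
    and "\<And>\<epsilon> \<sigma>. 0 < \<epsilon> \<Longrightarrow> \<sigma> \<in> binary_vectors \<Longrightarrow> 0 < \<P>(w in M. \<eta> w = \<sigma>) \<Longrightarrow>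
           distributed (uniform_measure M {w \<in> space M. \<eta> w = \<sigma>}) N (X \<epsilon>)
             (\<lambda>x. ennreal (exp (q x (\<epsilon> *\<^sub>R \<sigma>))))"
    and "\<And>x. x \<in> space N \<Longrightarrow> twice_continuously_differentiable (q x)"
    and "\<And>x. x \<in> space N \<Longrightarrow> \<gamma> x = gradient (q x) 0"
    and "\<And>x. x \<in> space N \<Longrightarrow> H x = hessian (q x) 0"
  shows "\<forall>t. \<forall>x\<in>space N.
    (\<lambda>\<epsilon>. log_odds M \<eta> q \<epsilon> t x -
       (ln (\<P>(w in M. \<eta> w $ t = 1) / \<P>(w in M. \<eta> w $ t = 0))
        + (\<gamma> x \<bullet> (cond_exp_coord M \<eta> 1 t (\<lambda>\<sigma>. \<sigma>) - cond_exp_coord M \<eta> 0 t (\<lambda>\<sigma>. \<sigma>))) * \<epsilon>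
        + 1 / 2 * (cond_exp_coord M \<eta> 1 t (\<lambda>\<sigma>. \<sigma> \<bullet> (H x *v \<sigma>))
                   - cond_exp_coord M \<eta> 0 t (\<lambda>\<sigma>. \<sigma> \<bullet> (H x *v \<sigma>))) * \<epsilon>\<^sup>2
        + 1 / 2 * (\<gamma> x \<bullet> ((cond_cov_coord M \<eta> 1 t - cond_cov_coord M \<eta> 0 t) *v \<gamma> x)) * \<epsilon>\<^sup>2))
      \<in> o[at_right 0](\<lambda>\<epsilon>. \<epsilon>\<^sup>2)"
proof (intro allI ballI)
  fix t :: 't and x assume x: "x \<in> space N"
  interpret P: prob_space M by fact
  have [measurable]: "(\<lambda>w. \<eta> w $ t) \<in> borel_measurable M"
    using assms(2) by (rule borel_measurable_vec_nth)
  let ?P = "\<lambda>i. \<P>(w in M. \<eta> w $ t = i)"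
  \<comment> \<open>Coordinates are binary, so the events for 0 and 1 are complementary, and the
    upper bound on \<open>?P 1\<close> makes \<open>?P 0\<close> positive.\<close>
  have "?P 0 = P.prob (space M - {w \<in> space M. \<eta> w $ t = 1})"
    using assms(3) by (intro arg_cong[where f=P.prob]) (force simp: binary_vectors_def)
  also have "\<dots> = 1 - ?P 1"
    by (rule P.prob_compl) measurable
  finally have P0: "0 < ?P 0" using assms(5)[of t] by simp
  note P1 = assms(4)[of t]
  interpret R0: random_binary_vector M \<eta> 0 t
    using assms(2,3) P0 by unfold_locales auto
  interpret R1: random_binary_vector M \<eta> 1 t
    using assms(2,3) P1 by unfold_locales auto
  let ?S = "\<lambda>i \<epsilon>. coord_density M \<eta> q \<epsilon> i t x"
  \<comment> \<open>The two posteriors share the same positive normalizing denominator, which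
    cancels in their ratio.\<close>
  have lo: "log_odds M \<eta> q \<epsilon> t x = ln (?P 1 / ?P 0) + ln (?S 1 \<epsilon>) - ln (?S 0 \<epsilon>)" for \<epsilon>
  proof -
    let ?a = "?P 1 * ?S 1 \<epsilon>" and ?b = "?P 0 * ?S 0 \<epsilon>"
    have ab: "0 < ?a" "0 < ?b"
      by (intro mult_pos_pos P0 P1 R0.coord_density_pos R1.coord_density_pos)+
    have "log_odds M \<eta> q \<epsilon> t x = ln (?a / ?b)"
      using ab by (simp add: log_odds_def posterior_def)
    also have "\<dots> = ln (?P 1 / ?P 0) + ln (?S 1 \<epsilon>) - ln (?S 0 \<epsilon>)"
      using P0 P1 R0.coord_density_pos[of q \<epsilon> x] R1.coord_density_pos[of q \<epsilon> x]
      by (simp add: ln_mult ln_div)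
    finally show ?thesis .
  qed
  note q = assms(10)[OF x]
  \<comment> \<open>Here \<open>c\<close> stands for \<open>q x 0\<close>, which cancels, and
    \<open>p\<close> for the prior log-odds, added and subtracted. The letters \<open>m\<close>,
    \<open>h\<close>, \<open>v\<close> are the gradient, Hessian and covariance terms for the two
    conditionings.\<close>
  have regroup: "(l1 - (c + m1 * e + (h1 + v1) / 2 * e\<^sup>2)) - (l0 - (c + m0 * e + (h0 + v0) / 2 * e\<^sup>2))
      = p + l1 - l0 - (p + (m1 - m0) * e + 1 / 2 * (h1 - h0) * e\<^sup>2 + 1 / 2 * (v1 - v0) * e\<^sup>2)"
    for l1 l0 c m1 m0 h1 h0 v1 v0 p e :: real
    by (simp add: algebra_simps add_divide_distrib diff_divide_distrib)
  show "(\<lambda>\<epsilon>. log_odds M \<eta> q \<epsilon> t x -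
       (ln (?P 1 / ?P 0)
        + (\<gamma> x \<bullet> (cond_exp_coord M \<eta> 1 t (\<lambda>\<sigma>. \<sigma>) - cond_exp_coord M \<eta> 0 t (\<lambda>\<sigma>. \<sigma>))) * \<epsilon>
        + 1 / 2 * (cond_exp_coord M \<eta> 1 t (\<lambda>\<sigma>. \<sigma> \<bullet> (H x *v \<sigma>))
                   - cond_exp_coord M \<eta> 0 t (\<lambda>\<sigma>. \<sigma> \<bullet> (H x *v \<sigma>))) * \<epsilon>\<^sup>2
        + 1 / 2 * (\<gamma> x \<bullet> ((cond_cov_coord M \<eta> 1 t - cond_cov_coord M \<eta> 0 t) *v \<gamma> x)) * \<epsilon>\<^sup>2))
      \<in> o[at_right 0](\<lambda>\<epsilon>. \<epsilon>\<^sup>2)"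
    using sum_in_smallo(2)[OF R1.ln_coord_density_expansion[where q=q and x=x, OF q]
        R0.ln_coord_density_expansion[where q=q and x=x, OF q]]
    unfolding lo assms(11)[OF x] assms(12)[OF x] inner_diff_right matrix_vector_mult_diff_rdistrib
    by (rule back_subst[where P="\<lambda>f. f \<in> _"]) (rule ext, rule regroup)
qed

end
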